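(* (1) For every $A\in\mathcal P_{\mathrm{fin},0}(\mathbb N_0)$, we have $[\![A]\!]=\mathcal P_{\mathrm{fin},0}(\mathbb N_0)$ if and only if $1\in A\cap\mathrm{rev}(A)$. (2) The only maximal divisor-closed submonoids of $\mathcal P_{\mathrm{fin},0}(\mathbb N_0)$ are $\mathcal P_{\mathrm{fin},0}(\mathbb N_0\setminus\{1\})$ and $\mathrm{rev}\big(\mathcal P_{\mathrm{fin},0}(\mathbb N_0\setminus\{1\})\big)$. More generally, given numerical monoids $S_1$ and $S_2$, the maximal divisor-closed submonoids of $\mathcal P_{\mathrm{fin},0}(S_1)\cap\mathrm{rev}(\mathcal P_{\mathrm{fin},0}(S_2))$ are precisely the monoids $\mathcal P_{\mathrm{fin},0}(S_1')\cap\mathrm{rev}(\mathcal P_{\mathrm{fin},0}(S_2))$ and $\mathcal P_{\mathrm{fin},0}(S_1)\cap\mathrm{rev}(\mathcal P_{\mathrm{fin},0}(S_2'))$, where $S_1'$ and $S_2'$ range over the maximal proper submonoids of $S_1$ and $S_2$, respectively. (3) There is a descending chain of divisor-closed submonoids of $\mathcal P_{\mathrm{fin},0}(\mathbb N_0)$ that does not become stationary. (4) Every ascending chain of divisor-closed submonoids of $\mathcal P_{\mathrm{fin},0}(\mathbb N_0)$ becomes stationary.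
   Context: A numerical monoid is an additive submonoid of $\mathbb N_0$ with $\gcd 1$. For a submonoid $S\subset\mathbb N_0$, $\mathcal P_{\mathrm{fin},0}(S)$ is the monoid of finite subsets of $S$ containing $0$ under set addition $A+B=\{a+b\colon a\in A,b\in B\}$ (identity $\{0\}$). For $B\in\mathcal P_{\mathrm{fin},0}(\mathbb N_0)$, $\mathrm{rev}(B)=\max B-B=\{\max B-b\colon b\in B\}$, and $\mathrm{rev}(H)=\{\mathrm{rev}(B)\colon B\in H\}$. $B$ divides $D$ if $D=B+C$ for some $C$ in the monoid; a submonoid is divisor-closed (in an ambient monoid $M$) if it contains all divisors in $M$ of its elements; a maximal divisor-closed submonoid of $M$ is a proper divisor-closed submonoid of $M$ not properly contained in any other proper divisor-closed submonoid of $M$. $[\![A]\!]=\{B\in\mathcal P_{\mathrm{fin},0}(\mathbb N_0)\colon B\text{ divides }nA\text{ for some }n\in\mathbb N_0\}$ is the smallest divisor-closed submonoid of $\mathcal P_{\mathrm{fin},0}(\mathbb N_0)$ containing $A$, where $nA$ is the $n$-fold sumset. *)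

theory Defs
  imports "HOL-Algebra.Divisibility" "HOL-Library.Set_Algebras"
begin

definition nat_add_monoid :: "nat set \<Rightarrow> nat monoid" where
  "nat_add_monoid S = \<lparr>carrier = S, mult = (+), one = 0\<rparr>"

definition numerical_monoid :: "nat set \<Rightarrow> bool" where
  "numerical_monoid S \<longleftrightarrow> submonoid S (nat_add_monoid UNIV) \<and> Gcd S = 1"

definition maximal_proper_submonoid :: "'a set \<Rightarrow> ('a, 'b) monoid_scheme \<Rightarrow> bool" where
  "maximal_proper_submonoid T M \<longleftrightarrow>
     submonoid T M \<and> T \<noteq> carrier M \<and>
     \<not> (\<exists>T'. submonoid T' M \<and> T' \<noteq> carrier M \<and> T \<subset> T')"

text \<open>\<open>S\<close> may be any set of naturals here; set addition turns \<open>Pfin0 S\<close> into a monoid if \<open>S\<close>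
  is closed under addition.\<close>

definition Pfin0 :: "nat set \<Rightarrow> nat set set" where
  "Pfin0 S = {A. finite A \<and> A \<subseteq> S \<and> 0 \<in> A}"

text \<open>The operation is the elementwise sum of sets from \<open>Set_Algebras\<close>. Hence divisibility and
  powers in this monoid are those with respect to set addition: \<open>A [^] n\<close> is the \<open>n\<close>-fold
  sumset \<open>nA\<close>.\<close>

definition sumset_monoid :: "nat set set \<Rightarrow> nat set monoid" where
  "sumset_monoid H = \<lparr>carrier = H, mult = (+), one = {0}\<rparr>"

text \<open>The truncated subtraction is harmless, since \<open>b \<le> Max B\<close> for all \<open>b \<in> B\<close>.\<close>

definition rev_set :: "nat set \<Rightarrow> nat set" where
  "rev_set B = (\<lambda>b. Max B - b) ` B"

definition divisor_closed_submonoid :: "'a set \<Rightarrow> ('a, 'b) monoid_scheme \<Rightarrow> bool" where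
  "divisor_closed_submonoid H M \<longleftrightarrow>
     submonoid H M \<and> (\<forall>D\<in>H. \<forall>B\<in>carrier M. B divides\<^bsub>M\<^esub> D \<longrightarrow> B \<in> H)"

definition maximal_divisor_closed_submonoid :: "'a set \<Rightarrow> ('a, 'b) monoid_scheme \<Rightarrow> bool" where
  "maximal_divisor_closed_submonoid H M \<longleftrightarrow>
     divisor_closed_submonoid H M \<and> H \<noteq> carrier M \<and>
     \<not> (\<exists>H'. divisor_closed_submonoid H' M \<and> H' \<noteq> carrier M \<and> H \<subset> H')"

definition divisor_hull :: "('a, 'b) monoid_scheme \<Rightarrow> 'a \<Rightarrow> 'a set" where
  "divisor_hull M A = {B \<in> carrier M. \<exists>n::nat. B divides\<^bsub>M\<^esub> (A [^]\<^bsub>M\<^esub> n)}"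

lemma rev_set_mem_iff:
  assumes "finite B" "0 \<in> B"
  shows "B \<in> rev_set ` Pfin0 S \<longleftrightarrow> rev_set B \<subseteq> S"
proof -
  have invol: "rev_set (rev_set C) = C \<and> 0 \<in> rev_set C \<and> finite (rev_set C)"
    if C: "finite C" "0 \<in> C" for C
  proof -
    have mx: "Max C \<in> C" and le: "\<And>c. c \<in> C \<Longrightarrow> c \<le> Max C"
      using C by (auto intro: Max_in)
    have max_rev: "Max (rev_set C) = Max C"
      unfolding rev_set_def
    proof (rule Max_eqI)
      show "Max C \<in> (\<lambda>b. Max C - b) ` C"
        using C by (force intro: image_eqI[of _ _ 0])
    qed (use C in auto)
    have "rev_set (rev_set C) = (\<lambda>c. Max C - (Max C - c)) ` C"
      unfolding rev_set_def[of "rev_set C"] max_rev by (simp add: rev_set_def image_image)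
    also have "\<dots> = id ` C"
      by (rule image_cong) (auto dest: le)
    finally have "rev_set (rev_set C) = C"
      by simp
    moreover have "0 \<in> rev_set C"
      using mx unfolding rev_set_def by (force intro: image_eqI[of _ _ "Max C"])
    moreover have "finite (rev_set C)"
      using C by (simp add: rev_set_def)
    ultimately show ?thesis by blast
  qed
  show ?thesis
  proof
    assume "B \<in> rev_set ` Pfin0 S"
    then show "rev_set B \<subseteq> S"
      using invol by (auto simp: Pfin0_def)
  next
    assume "rev_set B \<subseteq> S"
    then have "rev_set B \<in> Pfin0 S"
      using invol[OF assms] by (auto simp: Pfin0_def)
    then show "B \<in> rev_set ` Pfin0 S"
      using invol[OF assms] by (metis image_eqI)
  qed
qed

lemma rev_set_plus:
  assumes "finite A" "A \<noteq> {}" "finite B" "B \<noteq> {}"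
  shows "rev_set (A + B) = rev_set A + rev_set B"
proof -
  have le: "\<And>a. a \<in> A \<Longrightarrow> a \<le> Max A" "\<And>b. b \<in> B \<Longrightarrow> b \<le> Max B"
    using assms by auto
  have mx: "Max (A + B) = Max A + Max B"
  proof (rule Max_eqI)
    show "finite (A + B)" using assms by (simp add: finite_set_plus)
    show "Max A + Max B \<in> A + B" using assms by (intro set_plus_intro Max_in)
  qed (use le in \<open>auto elim!: set_plus_elim intro: add_mono\<close>)
  have diff: "Max A + Max B - (a + b) = (Max A - a) + (Max B - b)" if "a \<in> A" "b \<in> B" for a b
    using le(1)[OF that(1)] le(2)[OF that(2)] by simp
  show ?thesis
  proof
    show "rev_set (A + B) \<subseteq> rev_set A + rev_set B"
      unfolding rev_set_def mx by (auto elim!: set_plus_elim simp: diff intro!: set_plus_intro)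
    show "rev_set A + rev_set B \<subseteq> rev_set (A + B)"
      unfolding rev_set_def mx
      by (auto elim!: set_plus_elim simp flip: diff intro!: imageI set_plus_intro)
  qed
qed

lemma comm_monoid_sumset_monoid:
  assumes "submonoid S1 (nat_add_monoid UNIV)" "submonoid S2 (nat_add_monoid UNIV)"
  shows "comm_monoid (sumset_monoid (Pfin0 S1 \<inter> rev_set ` Pfin0 S2))"
proof -
  have S: "0 \<in> S1" "0 \<in> S2" "\<And>x y. x \<in> S1 \<Longrightarrow> y \<in> S1 \<Longrightarrow> x + y \<in> S1"
    "\<And>x y. x \<in> S2 \<Longrightarrow> y \<in> S2 \<Longrightarrow> x + y \<in> S2"
    using assms by (auto simp: submonoid_def nat_add_monoid_def)
  have mem: "A \<in> Pfin0 S1 \<inter> rev_set ` Pfin0 S2 \<longleftrightarrow>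
      finite A \<and> 0 \<in> A \<and> A \<subseteq> S1 \<and> rev_set A \<subseteq> S2" for A
    using rev_set_mem_iff[of A S2] by (auto simp: Pfin0_def)
  have closed: "A + B \<in> Pfin0 S1 \<inter> rev_set ` Pfin0 S2"
    if "A \<in> Pfin0 S1 \<inter> rev_set ` Pfin0 S2" "B \<in> Pfin0 S1 \<inter> rev_set ` Pfin0 S2" for A B
  proof -
    have AB: "finite A" "0 \<in> A" "A \<subseteq> S1" "rev_set A \<subseteq> S2"
      "finite B" "0 \<in> B" "B \<subseteq> S1" "rev_set B \<subseteq> S2"
      using that unfolding mem by auto
    have "rev_set (A + B) = rev_set A + rev_set B"
      using AB by (intro rev_set_plus) auto
    moreover have "rev_set A + rev_set B \<subseteq> S2" "A + B \<subseteq> S1"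
      using AB S by (blast elim: set_plus_elim)+
    moreover have "0 + 0 \<in> A + B"
      using AB by (intro set_plus_intro)
    ultimately show ?thesis
      using AB unfolding mem by (simp add: finite_set_plus)
  qed
  have zero: "{0} \<in> Pfin0 S1 \<inter> rev_set ` Pfin0 S2"
    unfolding mem using S by (simp add: rev_set_def)
  show ?thesis
    unfolding sumset_monoid_def
  proof (rule comm_monoidI, unfold partial_object.simps monoid.simps)
    fix A B C :: "nat set"
    show "A + B + C = A + (B + C)" "A + B = B + A" "{0} + A = A"
      by (simp_all add: ac_simps flip: set_zero)
  qed (fact closed zero)+
qed

end

theory Submission
  imports Defs
begin

text \<open>
  Write \<open>\<langle>A\<rangle>\<close> for the submonoid of \<open>\<nat>\<close> generated by \<open>A\<close>. By a theorem of Nathanson, for all large \<open>n\<close>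
  the sumset \<open>nA\<close> consists of the \<open>x \<le> n max A\<close> with \<open>x \<in> \<langle>A\<rangle>\<close> and \<open>n max A - x \<in> \<langle>rev A\<rangle>\<close>. Hence
  every \<open>B \<subseteq> \<langle>A\<rangle>\<close> with \<open>rev B \<subseteq> \<langle>rev A\<rangle>\<close> divides some \<open>nA\<close>: the cofactor is the set of the same shape
  below \<open>n max A - max B\<close>. Since submonoids of \<open>\<nat>\<close> are finitely generated, a divisor-closed submonoid
  \<open>H\<close> contains a single set \<open>A\<close> for which \<open>A\<close> generates \<open>\<Union>H\<close> and \<open>rev A\<close> generates the union of the
  reversed members of \<open>H\<close>. So \<open>H\<close> is determined by these two submonoids, and they can be chosen freely
  among cofinite ones. Maximality and the chain conditions are then read off from submonoids of \<open>\<nat>\<close>.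
\<close>

lemma submonoid_nat_add_iff:
  "submonoid T (nat_add_monoid S) \<longleftrightarrow> T \<subseteq> S \<and> 0 \<in> T \<and> (\<forall>x\<in>T. \<forall>y\<in>T. x + y \<in> T)"
  by (auto simp: submonoid_def nat_add_monoid_def)

abbreviation add_closed :: "nat set \<Rightarrow> bool" where
  "add_closed S \<equiv> submonoid S (nat_add_monoid UNIV)"

lemma add_closed_add: "add_closed S \<Longrightarrow> x \<in> S \<Longrightarrow> y \<in> S \<Longrightarrow> x + y \<in> S"
  by (simp add: submonoid_nat_add_iff)

lemma add_closed_mult:
  assumes "add_closed S" "x \<in> S"
  shows "k * x \<in> S"
  using assms by (induction k) (auto simp: submonoid_nat_add_iff)

subsection \<open>Submonoids of the natural numbers\<close>

text \<open>Two elements of \<open>S\<close> whose difference \<open>d\<close> divides all of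
  \<open>S\<close> generate every large multiple of \<open>d\<close>, and \<open>Gcd A\<close> is a
  multiple of \<open>d\<close>.\<close>

lemma large_multiples_mem_add_closed:
  assumes S: "add_closed S" and A: "A \<subseteq> S"
  obtains c where "\<And>x. x \<ge> c \<Longrightarrow> Gcd A dvd x \<Longrightarrow> x \<in> S"
proof (cases "S \<subseteq> {0}")
  case True
  then have "A \<subseteq> {0}"
    using A by auto
  then have "Gcd A = 0"
    by (simp add: Gcd_0_iff)
  moreover have "0 \<in> S"
    using S by (simp add: submonoid_nat_add_iff)
  ultimately show ?thesis
    by (intro that[of 0]) (auto simp only: dvd_0_left_iff)
next
  case False
  \<comment> \<open>The least positive difference \<open>d\<close> of two elements of \<open>S\<close> divides \<open>S\<close>, by division with remainder.\<close>
  define D where "D = {d. d > 0 \<and> (\<exists>x\<in>S. x + d \<in> S)}"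
  define d where "d = (LEAST d. d \<in> D)"
  have closed: "0 \<in> S" "\<And>x y. x \<in> S \<Longrightarrow> y \<in> S \<Longrightarrow> x + y \<in> S"
    using S by (auto simp: submonoid_nat_add_iff)
  from False obtain s where "s \<in> S" "s > 0"
    by auto
  then have "s \<in> D"
    using closed(1) by (auto simp: D_def intro!: bexI[of _ 0])
  then have "d \<in> D"
    unfolding d_def by (rule LeastI)
  then obtain x where d: "d > 0" and x: "x \<in> S" "x + d \<in> S"
    by (auto simp: D_def)
  have d_dvd: "d dvd t" if t: "t \<in> S" for t
  proof (rule ccontr)
    assume "\<not> d dvd t"
    then have pos: "t mod d > 0"
      by (simp add: dvd_eq_mod_eq_0)
    have "(t div d) * (x + d) + t mod d = t + (t div d) * x"
      by (simp add: algebra_simps)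
    moreover have "t + (t div d) * x \<in> S" "(t div d) * (x + d) \<in> S"
      using closed(2) t x add_closed_mult[OF S] by blast+
    ultimately have "\<exists>y\<in>S. y + t mod d \<in> S"
      by (intro bexI[of _ "(t div d) * (x + d)"]) (simp_all only:)
    then have "t mod d \<in> D"
      using pos by (simp add: D_def)
    then have "d \<le> t mod d"
      unfolding d_def by (rule Least_le)
    with d mod_less_divisor[of d t] show False
      by linarith
  qed
  then have dvd_Gcd: "d dvd Gcd A"
    using A by (auto intro!: Gcd_greatest)
  obtain q where q: "x = d * q"
    using d_dvd[OF x(1)] by blast
  show ?thesis
  proof (rule that)
    \<comment> \<open>For \<open>y = d * k\<close> and \<open>q > 0\<close>, the bound makes the
      quotient of \<open>k\<close> by \<open>q\<close> at least the remainder, so \<open>y\<close>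
      is a sum of \<open>k mod q\<close> copies of \<open>x + d\<close> and
      \<open>k div q - k mod q\<close> copies of \<open>x\<close>.\<close>
    fix y assume y: "d * (q * q) \<le> y" "Gcd A dvd y"
    obtain k where k: "y = d * k"
      using y(2) dvd_Gcd by (meson dvd_def dvd_trans)
    show "y \<in> S"
    proof (cases "q = 0")
      case True
      then show ?thesis
        using x(2) q k add_closed_mult[OF S, of d k] by (simp add: mult.commute)
    next
      case False
      have "q * q \<le> k"
        using y(1) d k by simp
      then have "q \<le> k div q"
        using False by (simp add: less_eq_div_iff_mult_less_eq)
      then have le: "k mod q \<le> k div q"
        using False by (meson le_trans less_imp_le_nat mod_less_divisor neq0_conv)
      have "(k div q - k mod q) * x + (k mod q) * (x + d)
          = ((k div q - k mod q) + k mod q) * x + (k mod q) * d"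
        by (simp add: algebra_simps)
      also have "\<dots> = (k div q) * x + (k mod q) * d"
        using le by simp
      also have "\<dots> = d * ((k div q) * q + k mod q)"
        by (simp only: q ring_distribs ac_simps)
      also have "\<dots> = y"
        unfolding div_mult_mod_eq k ..
      finally show ?thesis
        using closed(2) x add_closed_mult[OF S] by metis
    qed
  qed
qed

lemma add_closed_finitely_generated:
  assumes S: "add_closed S"
  obtains F where "finite F" "F \<subseteq> S" "\<And>T. add_closed T \<Longrightarrow> F \<subseteq> T \<Longrightarrow> S \<subseteq> T"
proof (cases "S \<subseteq> {0}")
  case True
  then show ?thesis
    using that[of "{}"] by (auto simp: submonoid_nat_add_iff)
next
  case False
  then obtain m where m: "m \<in> S" "m > 0"
    by auto
  \<comment> \<open>Least representatives of the residue classes modulo \<open>m\<close>, together with \<open>m\<close>, generate \<open>S\<close>.\<close>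
  define a where "a r = (LEAST x. x \<in> S \<and> x mod m = r)" for r
  have a: "a (x mod m) \<in> S \<and> a (x mod m) mod m = x mod m" "a (x mod m) \<le> x" if "x \<in> S" for x
    unfolding a_def by (rule LeastI[of _ x] Least_le, use that in simp)+
  show ?thesis
  proof (rule that)
    show "finite (insert m ((\<lambda>x. a (x mod m)) ` S))"
      using m by (auto intro!: finite_subset[of "(\<lambda>x. a (x mod m)) ` S" "a ` {..<m}"])
    show "insert m ((\<lambda>x. a (x mod m)) ` S) \<subseteq> S"
      using a m by auto
    fix T assume T: "add_closed T" "insert m ((\<lambda>x. a (x mod m)) ` S) \<subseteq> T"
    show "S \<subseteq> T"
    proof
      fix x assume x: "x \<in> S"
      have "m dvd x - a (x mod m)"
        using a[OF x] by (metis mod_eq_dvd_iff_nat)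
      then obtain i where "x - a (x mod m) = i * m"
        by (metis dvd_def mult.commute)
      then have "x = a (x mod m) + i * m"
        using a[OF x] by simp
      moreover have "i * m \<in> T" "a (x mod m) \<in> T"
        using T x add_closed_mult[of T m i] by auto
      ultimately show "x \<in> T"
        using T(1) by (metis submonoid_nat_add_iff)
    qed
  qed
qed

subsection \<open>Iterated sumsets\<close>

text \<open>The powers in \<open>sumset_monoid K\<close>, freed from the carrier
  \<open>K\<close>.\<close>

primrec nsum :: "nat \<Rightarrow> nat set \<Rightarrow> nat set" where
  "nsum 0 A = {0}"
| "nsum (Suc n) A = nsum n A + A"

lemma pow_sumset_monoid: "A [^]\<^bsub>sumset_monoid K\<^esub> (n::nat) = nsum n A"
  by (induction n) (simp_all add: nat_pow_def sumset_monoid_def)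

lemma nsum_add: "nsum (i + j) A = nsum i A + nsum j A"
  by (induction j) (simp_all add: ac_simps flip: set_zero)

lemma zero_mem_nsum: "0 \<in> A \<Longrightarrow> 0 \<in> nsum n A"
  by (induction n) (use set_plus_intro[of 0 _ 0] in force)+

lemma nsum_mono:
  assumes "0 \<in> A" "i \<le> j"
  shows "nsum i A \<subseteq> nsum j A"
proof -
  have "nsum j A = nsum i A + nsum (j - i) A"
    using assms nsum_add[of i "j - i" A] by simp
  then show ?thesis
    using set_plus_intro[OF _ zero_mem_nsum[OF assms(1)]] by fastforce
qed

lemma mult_mem_nsum: "a \<in> A \<Longrightarrow> n * a \<in> nsum n A"
  by (induction n) (auto simp: add.commute intro: set_plus_intro)

text \<open>A union of sumsets, so that membership comes with a number of summands to be
  controlled.\<close>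

definition gen :: "nat set \<Rightarrow> nat set" where
  "gen A = (\<Union>n. nsum n A)"

lemma add_closed_gen: "add_closed (gen A)"
proof -
  have "x + y \<in> gen A" if "x \<in> gen A" "y \<in> gen A" for x y
  proof -
    from that obtain i j where "x \<in> nsum i A" "y \<in> nsum j A"
      by (auto simp: gen_def)
    then have "x + y \<in> nsum (i + j) A"
      unfolding nsum_add by (rule set_plus_intro)
    then show ?thesis
      by (auto simp: gen_def)
  qed
  moreover have "0 \<in> gen A"
    unfolding gen_def by (auto intro: exI[of _ 0])
  ultimately show ?thesis
    by (auto simp: submonoid_nat_add_iff)
qed

lemma subset_gen: "A \<subseteq> gen A"
proof
  fix a assume "a \<in> A"
  then show "a \<in> gen A"
    using mult_mem_nsum[of a A 1] unfolding gen_def by (metis UN_I UNIV_I mult_1)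
qed

lemma gen_subset:
  assumes "add_closed T" "A \<subseteq> T"
  shows "gen A \<subseteq> T"
proof -
  have "nsum n A \<subseteq> T" for n
    using assms by (induction n) (auto simp: submonoid_nat_add_iff elim!: set_plus_elim)
  then show ?thesis
    by (auto simp: gen_def)
qed

section \<open>Reversal of sets and sumsets\<close>

lemma finite_rev_set: "finite A \<Longrightarrow> finite (rev_set A)"
  by (simp add: rev_set_def)

lemma zero_mem_rev_set: "finite A \<Longrightarrow> 0 \<in> A \<Longrightarrow> 0 \<in> rev_set A"
  unfolding rev_set_def by (force intro: image_eqI[of _ _ "Max A"] Max_in)

lemma Max_rev_set:
  assumes "finite A" "0 \<in> A"
  shows "Max (rev_set A) = Max A"
  unfolding rev_set_def
  by (rule Max_eqI) (use assms in \<open>auto intro: image_eqI[of _ _ 0]\<close>)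

lemma rev_set_rev_set:
  assumes "finite A" "0 \<in> A"
  shows "rev_set (rev_set A) = A"
proof -
  have "rev_set (rev_set A) = (\<lambda>a. Max A - (Max A - a)) ` A"
    unfolding rev_set_def[of "rev_set A"] Max_rev_set[OF assms] by (simp add: rev_set_def image_image)
  also have "\<dots> = id ` A"
    using assms by (intro image_cong) auto
  finally show ?thesis
    by simp
qed

lemma finite_nsum: "finite A \<Longrightarrow> finite (nsum n A)"
  by (induction n) (simp_all add: finite_set_plus)

lemma rev_set_nsum:
  assumes "finite A" "0 \<in> A"
  shows "rev_set (nsum n A) = nsum n (rev_set A)"
proof (induction n)
  case (Suc n)
  have "nsum n A \<noteq> {}" "A \<noteq> {}"
    using zero_mem_nsum assms by blast+
  then show ?case
    using assms Suc by (simp add: rev_set_plus finite_nsum)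
qed (simp add: rev_set_def)

text \<open>Replacing each summand \<open>a\<close> by \<open>Max A - a\<close> reflects the sum at
  \<open>n * Max A\<close>.\<close>

lemma nsum_reflect:
  assumes "finite A" "0 \<in> A" "x \<in> nsum n A"
  shows "x \<le> n * Max A \<and> n * Max A - x \<in> nsum n (rev_set A)"
  using assms(3)
proof (induction n arbitrary: x)
  case (Suc n)
  then obtain y a where x: "x = y + a" "y \<in> nsum n A" "a \<in> A"
    by (auto elim: set_plus_elim)
  have le: "a \<le> Max A" "y \<le> n * Max A"
    using assms x Suc.IH by auto
  then have "Suc n * Max A - x = (n * Max A - y) + (Max A - a)"
    by (simp add: x)
  moreover have "\<dots> \<in> nsum n (rev_set A) + rev_set A"
    using x Suc.IH by (intro set_plus_intro) (auto simp: rev_set_def)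
  ultimately show ?case
    using le by (simp add: x)
qed simp

text \<open>Elements of the reversal are differences of elements of \<open>A\<close>, hence
  multiples of its gcd; involutivity gives the other divisibility.\<close>

lemma Gcd_rev_set:
  assumes "finite A" "0 \<in> A"
  shows "Gcd (rev_set A) = Gcd A"
proof -
  have *: "Gcd B dvd Gcd (rev_set B)" if B: "finite B" "0 \<in> B" for B
  proof (rule Gcd_greatest)
    fix x assume "x \<in> rev_set B"
    then obtain b where "b \<in> B" "x = Max B - b"
      by (auto simp: rev_set_def)
    moreover have "Max B \<in> B"
      using B by (intro Max_in) auto
    ultimately show "Gcd B dvd x"
      by (auto intro!: dvd_diff_nat)
  qed
  from *[OF assms] *[of "rev_set A"] show ?thesis
    using assms by (simp add: rev_set_rev_set finite_rev_set zero_mem_rev_set dvd_antisym)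
qed

section \<open>Nathanson's structure theorem\<close>

text \<open>The least element of \<open>gen A\<close> in each residue class modulo \<open>m\<close>
  costs boundedly many summands, and \<open>x\<close> arises from the one in its class by adding at
  most \<open>x div m\<close> copies of \<open>m\<close>.\<close>

lemma gen_mem_nsum_bound:
  assumes A: "0 \<in> A" "m \<in> A" "m > 0"
  obtains k where "\<And>x. x \<in> gen A \<Longrightarrow> x \<in> nsum (k + x div m) A"
proof -
  define a where "a r = (LEAST x. x \<in> gen A \<and> x mod m = r)" for r
  have a: "a (x mod m) \<in> gen A \<and> a (x mod m) mod m = x mod m" "a (x mod m) \<le> x"
    if "x \<in> gen A" for x
    unfolding a_def by (rule LeastI[of _ x] Least_le, use that in simp)+
  define f where "f y = (LEAST k. y \<in> nsum k A)" for y
  have f: "y \<in> nsum (f y) A" if "y \<in> gen A" for y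
    using that unfolding f_def gen_def by (auto intro: LeastI)
  \<comment> \<open>Classes that miss \<open>gen A\<close> contribute unspecified values, which can
    only enlarge the maximum.\<close>
  define k where "k = Max (f ` a ` {..<m})"
  show ?thesis
  proof (rule that)
    fix x assume x: "x \<in> gen A"
    define y where "y = a (x mod m)"
    have "m dvd x - y"
      using a[OF x] unfolding y_def by (metis mod_eq_dvd_iff_nat)
    then obtain i where "x - y = i * m"
      by (metis dvd_def mult.commute)
    then have xi: "x = y + i * m"
      using a[OF x] by (simp add: y_def)
    have "f y \<le> k"
      unfolding k_def y_def using A by (intro Max_ge) auto
    then have "y \<in> nsum k A"
      using f a[OF x] nsum_mono[OF A(1)] unfolding y_def by blast
    then have "x \<in> nsum (k + i) A"
      unfolding xi nsum_add by (intro set_plus_intro mult_mem_nsum A)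
    moreover have "i \<le> x div m"
      using A(3) by (simp add: xi)
    ultimately show "x \<in> nsum (k + x div m) A"
      using nsum_mono[OF A(1), of "k + i" "k + x div m"] by auto
  qed
qed

text \<open>Reflection gives the inclusion from left to right. Conversely, a point can be reached
  from below with \<open>A\<close> or from above with \<open>rev_set A\<close>; for large
  \<open>n\<close> one of the two ways gets by with \<open>n\<close> summands.\<close>

lemma nsum_structure:
  assumes A: "finite A" "0 \<in> A" and m: "Max A > 0"
  obtains n0 where "\<And>n. n \<ge> n0 \<Longrightarrow>
    nsum n A = {x. x \<le> n * Max A \<and> x \<in> gen A \<and> n * Max A - x \<in> gen (rev_set A)}"
proof -
  let ?m = "Max A"
  let ?R = "rev_set A"
  have mem: "?m \<in> A" "?m \<in> ?R"
    using A Max_in[of A] Max_in[of ?R]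
    by (metis Max_rev_set empty_iff finite_rev_set zero_mem_rev_set)+
  have R: "finite ?R" "0 \<in> ?R"
    using A by (simp_all add: finite_rev_set zero_mem_rev_set)
  obtain k where k: "\<And>x. x \<in> gen A \<Longrightarrow> x \<in> nsum (k + x div ?m) A"
    using gen_mem_nsum_bound A mem m by metis
  obtain l where l: "\<And>x. x \<in> gen ?R \<Longrightarrow> x \<in> nsum (l + x div ?m) ?R"
    using gen_mem_nsum_bound R mem m by metis
  show ?thesis
  proof (rule that, intro equalityI subsetI CollectI)
    \<comment> \<open>If \<open>k + x div Max A\<close> exceeds \<open>n\<close>, the reflection of
      \<open>x\<close> is at most \<open>k * Max A\<close> and needs at most \<open>l + k\<close>
      summands; hence this threshold.\<close>
    fix n x assume n: "k + l \<le> n"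
    { assume "x \<in> nsum n A"
      then show "x \<le> n * ?m \<and> x \<in> gen A \<and> n * ?m - x \<in> gen ?R"
        using nsum_reflect[OF A] by (auto simp: gen_def) }
    assume x: "x \<in> {x. x \<le> n * ?m \<and> x \<in> gen A \<and> n * ?m - x \<in> gen ?R}"
    show "x \<in> nsum n A"
    \<comment> \<open>If \<open>x\<close> is too close to \<open>n * Max A\<close>, its reflection is small and the bound for \<open>rev_set A\<close> applies.\<close>
    proof (cases "k + x div ?m \<le> n")
      case True
      then show ?thesis
        using k x nsum_mono[OF A(2) True] by blast
    next
      case False
      define y where "y = n * ?m - x"
      have "n - k < x div ?m"
        using False n by linarith
      then have "(n - k + 1) * ?m \<le> x"
        using m by (simp add: less_eq_div_iff_mult_less_eq flip: Suc_le_eq)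
      moreover have "n * ?m = (n - k) * ?m + k * ?m"
        using n by (simp flip: add_mult_distrib)
      ultimately have "y \<le> k * ?m"
        unfolding y_def by simp
      then have "y div ?m \<le> k"
        using m by (metis div_le_mono nonzero_mult_div_cancel_right neq0_conv)
      then have "l + y div ?m \<le> n"
        using n by simp
      then have "y \<in> nsum n ?R"
        using l[of y] x nsum_mono[OF R(2)] unfolding y_def by blast
      then have "n * ?m - y \<in> nsum n A"
        using nsum_reflect[OF R] A by (auto simp: Max_rev_set rev_set_rev_set)
      moreover have "n * ?m - y = x"
        using x by (simp add: y_def)
      ultimately show ?thesis
        by simp
    qed
  qed
qed

subsection \<open>Divisor-closed submonoids\<close>

text \<open>All divisor-closed submonoids turn out to have this form; choosing \<open>UNIV\<close>
  for one argument gives \<open>Pfin0\<close> or its reversal.\<close>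

definition bimonoid :: "nat set \<Rightarrow> nat set \<Rightarrow> nat set set" where
  "bimonoid S T = Pfin0 S \<inter> rev_set ` Pfin0 T"

lemma mem_bimonoid_iff:
  "A \<in> bimonoid S T \<longleftrightarrow> finite A \<and> 0 \<in> A \<and> A \<subseteq> S \<and> rev_set A \<subseteq> T"
  using rev_set_mem_iff[of A T] by (auto simp: Pfin0_def bimonoid_def)

text \<open>For large \<open>n\<close>, \<open>nsum n A\<close> is \<open>W L\<close> with
  \<open>L = n * Max A\<close>, and the cofactor is \<open>W (L - Max B)\<close>: its translates by
  0 and by \<open>Max B\<close> already cover \<open>W L\<close>. The membership of \<open>C\<close>
  is recorded because divisibility asks for a cofactor in the ambient monoid.\<close>

lemma bimonoid_divides_nsum:
  assumes A: "finite A" "0 \<in> A" and B: "B \<in> bimonoid (gen A) (gen (rev_set A))"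
  obtains n C where "C \<in> bimonoid (gen A) (gen (rev_set A))" "nsum n A = B + C"
proof (cases "Max A = 0")
  case True
  then have "A \<subseteq> {0}"
    using A by (metis Max_ge bot_nat_0.extremum_uniqueI insertI1 subsetI)
  then have "gen A \<subseteq> {0}"
    using gen_subset[of "{0}" A] by (auto simp: submonoid_nat_add_iff)
  then have "B = {0}"
    using B by (auto simp: mem_bimonoid_iff)
  then show ?thesis
    using that[of "{0}" 0] B by (simp flip: set_zero)
next
  case False
  let ?m = "Max A"
  let ?R = "rev_set A"
  let ?S = "gen A"
  let ?T = "gen ?R"
  let ?b = "Max B"
  define d where "d = Gcd A"
  define W where "W L = {x. x \<le> L \<and> x \<in> ?S \<and> L - x \<in> ?T}" for L
  obtain c1 where c1: "\<And>x. x \<ge> c1 \<Longrightarrow> d dvd x \<Longrightarrow> x \<in> ?S"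
    using large_multiples_mem_add_closed[OF add_closed_gen subset_gen] unfolding d_def by metis
  obtain c2 where c2: "\<And>x. x \<ge> c2 \<Longrightarrow> d dvd x \<Longrightarrow> x \<in> ?T"
    using large_multiples_mem_add_closed[OF add_closed_gen subset_gen, of ?R] A
    unfolding d_def by (metis Gcd_rev_set)
  define c where "c = max c1 c2"
  have c: "x \<in> ?S" "x \<in> ?T" if "x \<ge> c" "d dvd x" for x
    using c1 c2 that by (auto simp: c_def)
  have dvd_gen: "d dvd x" if "x \<in> ?S" for x
  proof -
    have "gen A \<subseteq> {x. d dvd x}"
      by (rule gen_subset) (auto simp: submonoid_nat_add_iff d_def)
    then show ?thesis
      using that by auto
  qed
  obtain n0 where n0: "\<And>n. n \<ge> n0 \<Longrightarrow> nsum n A = W (n * ?m)"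
    using nsum_structure[OF A] False unfolding W_def by auto
  \<comment> \<open>Large enough for the structure theorem, and such that a point above
    \<open>L - ?b - c\<close> lies above \<open>?b + c\<close>.\<close>
  define n where "n = n0 + 2 * ?b + 2 * c"
  define L where "L = n * ?m"
  have "n * 1 \<le> L"
    unfolding L_def using False by (intro mult_le_mono2) simp
  then have L: "2 * ?b + 2 * c \<le> L"
    by (simp add: n_def)
  have nL: "nsum n A = W L"
    unfolding L_def by (rule n0) (simp add: n_def)
  have dL: "d dvd L"
    unfolding L_def d_def using A by (intro dvd_mult Gcd_dvd Max_in) auto
  have Bfin: "finite B" "0 \<in> B" "B \<subseteq> ?S" "rev_set B \<subseteq> ?T" and b: "?b \<in> B"
    using B by (auto simp: mem_bimonoid_iff intro: Max_in)
  then have db: "d dvd ?b"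
    using dvd_gen by auto
  have zero: "0 \<in> ?S" "0 \<in> ?T"
    using add_closed_gen by (auto simp: submonoid_nat_add_iff)
  have ends: "0 \<in> W (L - ?b)" "L - ?b \<in> W (L - ?b)"
    unfolding W_def using L zero c[of "L - ?b"] dL db by (auto intro: dvd_diff_nat)
  have fin: "finite (W (L - ?b))"
    unfolding W_def by (rule finite_subset[of _ "{..L - ?b}"]) auto
  have Max_W: "Max (W (L - ?b)) = L - ?b"
    using fin ends by (intro Max_eqI) (auto simp: W_def)
  have "W (L - ?b) \<in> bimonoid ?S ?T"
    unfolding mem_bimonoid_iff rev_set_def[of "W _"] Max_W using fin ends by (auto simp: W_def)
  moreover have "W L = B + W (L - ?b)"
  proof (intro equalityI subsetI)
    fix x assume x: "x \<in> W L"
    then have dx: "d dvd x"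
      using dvd_gen by (auto simp: W_def)
    show "x \<in> B + W (L - ?b)"
    \<comment> \<open>For low \<open>x\<close> the summand \<open>0 \<in> B\<close> is used, for
      high \<open>x\<close> the summand \<open>?b\<close>. The single condition not inherited from
      \<open>x\<close> concerns a multiple of \<open>d\<close> that is at least
      \<open>c\<close>.\<close>
    proof (cases "x + ?b + c \<le> L")
      case True
      then have "L - ?b - x \<in> ?T"
        using dL db dx by (intro c) (auto intro: dvd_diff_nat)
      then have "x \<in> W (L - ?b)"
        using x True by (auto simp: W_def)
      then have "0 + x \<in> B + W (L - ?b)"
        using Bfin by (intro set_plus_intro)
      then show ?thesis
        by simp
    next
      case False
      then have ge: "x - ?b \<ge> c" "x \<ge> ?b"
        using L by auto
      then have "x - ?b \<in> ?S"
        using db dx by (intro c) (auto intro: dvd_diff_nat)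
      then have "x - ?b \<in> W (L - ?b)"
        using x ge by (auto simp: W_def)
      then have "?b + (x - ?b) \<in> B + W (L - ?b)"
        using b by (intro set_plus_intro)
      then show ?thesis
        using ge by simp
    qed
  next
    fix x assume "x \<in> B + W (L - ?b)"
    then obtain u v where x: "x = u + v" "u \<in> B" "v \<in> W (L - ?b)"
      by (rule set_plus_elim)
    have u: "u \<le> ?b" "?b - u \<in> ?T" "u \<in> ?S"
      using x Bfin by (auto simp: rev_set_def)
    have le: "L - x = (?b - u) + (L - ?b - v)" "x \<le> L"
      using x u L by (auto simp: W_def)
    have "u + v \<in> ?S" "(?b - u) + (L - ?b - v) \<in> ?T"
      using x u unfolding W_def by (blast intro: add_closed_add[OF add_closed_gen])+
    with le show "x \<in> W L"
      by (simp add: W_def flip: x(1))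
  qed
  ultimately show ?thesis
    using nL that by metis
qed

section \<open>From divisor-closed submonoids to pairs of submonoids\<close>

lemma divisor_closed_sumset_iff:
  "divisor_closed_submonoid H (sumset_monoid K) \<longleftrightarrow>
     H \<subseteq> K \<and> {0} \<in> H \<and> (\<forall>A\<in>H. \<forall>B\<in>H. A + B \<in> H) \<and>
     (\<forall>B\<in>K. \<forall>C\<in>K. B + C \<in> H \<longrightarrow> B \<in> H)"
  unfolding divisor_closed_submonoid_def submonoid_def sumset_monoid_def factor_def
    partial_object.simps monoid.simps
  by blast

lemma bimonoid_mono: "S \<subseteq> S' \<Longrightarrow> T \<subseteq> T' \<Longrightarrow> bimonoid S T \<subseteq> bimonoid S' T'"
  by (fastforce simp: mem_bimonoid_iff)

text \<open>\<open>B\<close> divides a multiple of \<open>A\<close>, with a cofactor in the ambient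
  monoid because \<open>gen A\<close> stays in \<open>S\<close> and \<open>gen (rev_set A)\<close>
  in \<open>T\<close>.\<close>

lemma mem_divisor_closed_if_mem_bimonoid_gen:
  assumes ST: "add_closed S" "add_closed T"
    and H: "divisor_closed_submonoid H (sumset_monoid (bimonoid S T))"
    and A: "A \<in> H" and B: "B \<in> bimonoid (gen A) (gen (rev_set A))"
  shows "B \<in> H"
proof -
  note H = H[unfolded divisor_closed_sumset_iff]
  have A': "finite A" "0 \<in> A" "A \<subseteq> S" "rev_set A \<subseteq> T"
    using H A mem_bimonoid_iff by blast+
  obtain n C where C: "C \<in> bimonoid (gen A) (gen (rev_set A))" "nsum n A = B + C"
    using bimonoid_divides_nsum[OF A'(1,2) B] .
  have "{0} \<in> H" "\<forall>A\<in>H. \<forall>B\<in>H. A + B \<in> H"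
    using H by blast+
  then have "nsum n A \<in> H"
    using A by (induction n) auto
  moreover have "bimonoid (gen A) (gen (rev_set A)) \<subseteq> bimonoid S T"
    using A' ST by (intro bimonoid_mono gen_subset)
  ultimately have "B \<in> bimonoid S T" "C \<in> bimonoid S T" "B + C \<in> H"
    using B C by auto
  then show ?thesis
    using H by blast
qed

text \<open>Each of finitely many generators of the union lies in a member; since all members
  contain 0, the sum of these members contains all the generators. The family is abstract so as to
  apply both to \<open>H\<close> and to its reversed members.\<close>

lemma sum_closed_family:
  assumes zero: "{0} \<in> G" "\<And>A. A \<in> G \<Longrightarrow> 0 \<in> A"
    and sum: "\<And>A B. A \<in> G \<Longrightarrow> B \<in> G \<Longrightarrow> A + B \<in> G"
  shows add_closed_Union: "add_closed (\<Union>G)" and ex_gen_Union: "\<exists>A\<in>G. \<Union>G \<subseteq> gen A"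
proof -
  show closed: "add_closed (\<Union>G)"
    unfolding submonoid_nat_add_iff using zero(1) sum by (blast intro: set_plus_intro)
  obtain F where F: "finite F" "F \<subseteq> \<Union>G" "\<And>T. add_closed T \<Longrightarrow> F \<subseteq> T \<Longrightarrow> \<Union>G \<subseteq> T"
    using add_closed_finitely_generated[OF closed] by metis
  have "\<exists>A\<in>G. F \<subseteq> A"
    using F(1,2)
  proof (induction F)
    case (insert x F)
    then obtain A B where AB: "A \<in> G" "F \<subseteq> A" "B \<in> G" "x \<in> B"
      by auto
    moreover have "B \<subseteq> A + B" "A \<subseteq> A + B"
      using set_zero_plus2[of A B] set_zero_plus2[of B A] zero(2) AB by (simp_all add: add.commute)
    ultimately show ?case
      using sum by (intro bexI[of _ "A + B"]) auto
  qed (use zero in auto)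
  then show "\<exists>A\<in>G. \<Union>G \<subseteq> gen A"
    using F(3) add_closed_gen subset_gen by (meson subset_trans)
qed

lemma rev_set_plus_bimonoid:
  "A \<in> bimonoid S T \<Longrightarrow> B \<in> bimonoid S' T' \<Longrightarrow> rev_set (A + B) = rev_set A + rev_set B"
  by (intro rev_set_plus) (auto simp: mem_bimonoid_iff)

lemma subset_plus_bimonoid:
  assumes "A \<in> bimonoid S T" "B \<in> bimonoid S T"
  shows "A \<subseteq> A + B" "rev_set A \<subseteq> rev_set (A + B)"
  using assms set_zero_plus2[of B A] set_zero_plus2[of "rev_set B" "rev_set A"]
  by (auto simp: rev_set_plus_bimonoid add.commute mem_bimonoid_iff zero_mem_rev_set)

text \<open>One member generates \<open>\<Union>H\<close>, the reversal of another generates the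
  union of the reversed members, and the sum of the two members serves both purposes.\<close>

lemma divisor_closed_gen:
  assumes H: "divisor_closed_submonoid H (sumset_monoid (bimonoid S T))"
  shows "add_closed (\<Union>H)" "add_closed (\<Union>(rev_set ` H))"
    "\<exists>A\<in>H. \<Union>H \<subseteq> gen A \<and> \<Union>(rev_set ` H) \<subseteq> gen (rev_set A)"
proof -
  note H = H[unfolded divisor_closed_sumset_iff]
  have HB: "A \<in> bimonoid S T" if "A \<in> H" for A
    using H that by auto
  have "rev_set {0} = {0}"
    by (simp add: rev_set_def)
  then have rev1: "{0} \<in> rev_set ` H"
    using H by (metis imageI)
  have rev2: "0 \<in> A" if "A \<in> rev_set ` H" for A
    using that HB by (auto simp: mem_bimonoid_iff zero_mem_rev_set)
  have rev3: "A + B \<in> rev_set ` H" if AB: "A \<in> rev_set ` H" "B \<in> rev_set ` H" for A B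
  proof -
    obtain A' B' where "A = rev_set A'" "B = rev_set B'" "A' \<in> H" "B' \<in> H"
      using AB by blast
    moreover from this have "A + B = rev_set (A' + B')"
      by (simp add: rev_set_plus_bimonoid[OF HB HB])
    ultimately show ?thesis
      using H by blast
  qed
  note rev = rev1 rev2 rev3
  have norev: "{0} \<in> H" "\<And>A. A \<in> H \<Longrightarrow> 0 \<in> A" "\<And>A B. A \<in> H \<Longrightarrow> B \<in> H \<Longrightarrow> A + B \<in> H"
    using H HB mem_bimonoid_iff by blast+
  show "add_closed (\<Union>H)" "add_closed (\<Union>(rev_set ` H))"
    by (rule add_closed_Union[OF norev]; assumption) (rule add_closed_Union[OF rev]; assumption)
  obtain A where A: "A \<in> H" "\<Union>H \<subseteq> gen A"
    using ex_gen_Union[OF norev] by auto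
  obtain B where B: "B \<in> H" "\<Union>(rev_set ` H) \<subseteq> gen (rev_set B)"
    using ex_gen_Union[OF rev] by auto
  have "A \<subseteq> A + B" "rev_set B \<subseteq> rev_set (A + B)"
    using subset_plus_bimonoid HB A B by (metis add.commute)+
  then have "gen A \<subseteq> gen (A + B)" "gen (rev_set B) \<subseteq> gen (rev_set (A + B))"
    by (meson add_closed_gen gen_subset subset_gen subset_trans)+
  then show "\<exists>A\<in>H. \<Union>H \<subseteq> gen A \<and> \<Union>(rev_set ` H) \<subseteq> gen (rev_set A)"
    using A B norev(3) by (metis subset_trans)
qed

theorem divisor_closed_eq_bimonoid:
  assumes "add_closed S" "add_closed T"
    and H: "divisor_closed_submonoid H (sumset_monoid (bimonoid S T))"
  shows "H = bimonoid (\<Union>H) (\<Union>(rev_set ` H))"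
proof
  have "finite B \<and> 0 \<in> B" if "B \<in> H" for B
    using that H by (auto simp: divisor_closed_sumset_iff mem_bimonoid_iff)
  then show "H \<subseteq> bimonoid (\<Union>H) (\<Union>(rev_set ` H))"
    unfolding mem_bimonoid_iff subset_iff[of H] by blast
  obtain A where A: "A \<in> H" "\<Union>H \<subseteq> gen A" "\<Union>(rev_set ` H) \<subseteq> gen (rev_set A)"
    using divisor_closed_gen(3)[OF H] by auto
  then show "bimonoid (\<Union>H) (\<Union>(rev_set ` H)) \<subseteq> H"
    using mem_divisor_closed_if_mem_bimonoid_gen[OF assms A(1)] bimonoid_mono[OF A(2,3)] by blast
qed

text \<open>Adding a set that contains 0 only enlarges a set, also after reversal, so both
  containments pass to divisors.\<close>

lemma divisor_closed_bimonoid: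
  assumes UV: "add_closed U" "add_closed V" and "U \<subseteq> S" "V \<subseteq> T"
  shows "divisor_closed_submonoid (bimonoid U V) (sumset_monoid (bimonoid S T))"
proof -
  have "comm_monoid (sumset_monoid (bimonoid U V))"
    unfolding bimonoid_def using UV by (rule comm_monoid_sumset_monoid)
  then have "{0} \<in> bimonoid U V" "\<forall>A\<in>bimonoid U V. \<forall>B\<in>bimonoid U V. A + B \<in> bimonoid U V"
    using monoid.one_closed monoid.m_closed
    by (fastforce simp: comm_monoid_def sumset_monoid_def)+
  moreover have "B \<in> bimonoid U V"
    if B: "B \<in> bimonoid S T" "C \<in> bimonoid S T" "B + C \<in> bimonoid U V" for B C
    using subset_plus_bimonoid[OF B(1,2)] B by (auto simp: mem_bimonoid_iff)
  ultimately show ?thesis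
    unfolding divisor_closed_sumset_iff using bimonoid_mono[OF assms(3,4)] by blast
qed

lemma rev_set_image_bimonoid: "rev_set ` bimonoid S T = bimonoid T S"
proof -
  have *: "rev_set ` bimonoid S T \<subseteq> bimonoid T S" for S T
    by (auto simp: mem_bimonoid_iff rev_set_rev_set finite_rev_set zero_mem_rev_set)
  moreover have "A \<in> rev_set ` bimonoid S T" if "A \<in> bimonoid T S" for A
    using that *[of T S] by (intro image_eqI[of _ _ "rev_set A"]) (auto simp: rev_set_rev_set mem_bimonoid_iff finite_rev_set zero_mem_rev_set)
  ultimately show ?thesis
    by blast
qed

text \<open>Any \<open>x \<in> U\<close> lies in \<open>{0, x, x + c}\<close>, whose reversal has
  only 0 and numbers from \<open>c\<close> on. Thus \<open>U\<close> is recovered from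
  \<open>bimonoid U V\<close>, and \<open>V\<close> by reversal.\<close>

lemma Union_bimonoid:
  assumes "0 \<in> U" "0 \<in> V" "{c..} \<subseteq> U" "{c..} \<subseteq> V"
  shows "\<Union>(bimonoid U V) = U"
proof
  show "U \<subseteq> \<Union>(bimonoid U V)"
  proof
    fix x assume x: "x \<in> U"
    have "Max {0, x, x + c} = x + c"
      by (rule Max_eqI) auto
    then have "rev_set {0, x, x + c} = {x + c, c, 0}"
      by (simp add: rev_set_def)
    then have "{0, x, x + c} \<in> bimonoid U V"
      unfolding mem_bimonoid_iff using assms x by auto
    then show "x \<in> \<Union>(bimonoid U V)"
      by blast
  qed
qed (auto simp: mem_bimonoid_iff)

section \<open>Maximal submonoids\<close>

lemma numerical_monoid_cofinite:
  assumes "numerical_monoid S"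
  obtains c where "{c..} \<subseteq> S"
proof -
  have "add_closed S" "Gcd S = 1"
    using assms by (auto simp: numerical_monoid_def)
  then obtain c where "\<And>x. c \<le> x \<Longrightarrow> x \<in> S"
    using large_multiples_mem_add_closed[of S S] by (metis order_refl one_dvd)
  then show ?thesis
    using that[of c] by auto
qed

text \<open>The least element \<open>s\<close> of \<open>S - T\<close> is no sum of two elements of
  \<open>S - {s}\<close>: these would be smaller, hence in \<open>T\<close>. So removing
  \<open>s\<close> leaves a submonoid, which is maximal.\<close>

lemma proper_submonoid_subset_maximal:
  assumes "add_closed S" "submonoid T (nat_add_monoid S)" "T \<noteq> S"
  obtains s where "s \<in> S" "T \<subseteq> S - {s}" "maximal_proper_submonoid (S - {s}) (nat_add_monoid S)"
proof -
  define s where "s = (LEAST s. s \<in> S - T)"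
  have T: "T \<subseteq> S" "0 \<in> T" "\<And>x y. x \<in> T \<Longrightarrow> y \<in> T \<Longrightarrow> x + y \<in> T"
    using assms by (auto simp: submonoid_nat_add_iff)
  then obtain t where "t \<in> S - T"
    using assms(3) by auto
  then have s: "s \<in> S - T"
    unfolding s_def by (rule LeastI)
  have less: "x \<in> T" if "x \<in> S" "x < s" for x
    using not_less_Least[of x "\<lambda>s. s \<in> S - T"] that by (auto simp: s_def)
  have "x + y \<noteq> s" if "x \<in> S - {s}" "y \<in> S - {s}" for x y
  proof
    assume "x + y = s"
    moreover from this that have "x < s" "y < s"
      by (cases "y = 0"; cases "x = 0"; auto)+
    ultimately show False
      using less T(3) s that by blast
  qed
  then have "submonoid (S - {s}) (nat_add_monoid S)"
    using assms(1) s T(2) unfolding submonoid_nat_add_iff by blast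
  moreover have "T' = S" if "submonoid T' (nat_add_monoid S)" "S - {s} \<subset> T'" for T'
    using that s by (auto simp: submonoid_nat_add_iff)
  ultimately have "maximal_proper_submonoid (S - {s}) (nat_add_monoid S)"
    using s by (auto simp: maximal_proper_submonoid_def nat_add_monoid_def)
  then show ?thesis
    using that s T by auto
qed

lemma maximal_proper_submonoidD:
  assumes "maximal_proper_submonoid T (nat_add_monoid S)"
  shows "submonoid T (nat_add_monoid S)" "T \<subseteq> S" "T \<noteq> S"
    "\<And>T'. submonoid T' (nat_add_monoid S) \<Longrightarrow> T \<subseteq> T' \<Longrightarrow> T' = T \<or> T' = S"
  using assms by (auto simp: maximal_proper_submonoid_def nat_add_monoid_def submonoid_def)

lemma add_closed_submonoid: "submonoid T (nat_add_monoid S) \<Longrightarrow> add_closed T"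
  by (auto simp: submonoid_nat_add_iff)

text \<open>Being maximal, \<open>T\<close> omits a single element of \<open>S\<close>.\<close>

lemma maximal_proper_submonoid_cofinite:
  assumes S: "add_closed S" "{c..} \<subseteq> S" and T: "maximal_proper_submonoid T (nat_add_monoid S)"
  obtains c' where "{c'..} \<subseteq> T"
proof -
  note T' = maximal_proper_submonoidD[OF T]
  obtain s where s: "T \<subseteq> S - {s}" "maximal_proper_submonoid (S - {s}) (nat_add_monoid S)"
    using proper_submonoid_subset_maximal[OF S(1) T'(1,3)] by metis
  then have "T = S - {s}"
    using T'(4) maximal_proper_submonoidD[OF s(2)] by metis
  then have "{max c (Suc s)..} \<subseteq> T"
    using S(2) by auto
  then show ?thesis
    using that by blast
qed

text \<open>The candidates form an antichain and every proper divisor-closed submonoid lies in one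
  of them, so they are exactly the maximal ones.\<close>

theorem maximal_divisor_closed_bimonoid_iff:
  assumes S: "add_closed S" "{c..} \<subseteq> S" and T: "add_closed T" "{c'..} \<subseteq> T"
  shows "maximal_divisor_closed_submonoid H (sumset_monoid (bimonoid S T)) \<longleftrightarrow>
    (\<exists>U V. H = bimonoid U V \<and>
      (maximal_proper_submonoid U (nat_add_monoid S) \<and> V = T \<or>
       U = S \<and> maximal_proper_submonoid V (nat_add_monoid T)))"
    (is "?maxH \<longleftrightarrow> (\<exists>U V. H = bimonoid U V \<and> ?pair U V)")
proof -
  let ?M = "sumset_monoid (bimonoid S T)"
  have carrier: "carrier ?M = bimonoid S T"
    by (simp add: sumset_monoid_def)
  have pair: "divisor_closed_submonoid (bimonoid U V) ?M \<and> \<Union>(bimonoid U V) = U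
      \<and> \<Union>(rev_set ` bimonoid U V) = V \<and> bimonoid U V \<noteq> bimonoid S T"
    if UV: "?pair U V" for U V
  proof -
    have sub: "U \<subseteq> S" "V \<subseteq> T" "add_closed U" "add_closed V" "U \<noteq> S \<or> V \<noteq> T"
      using UV S T maximal_proper_submonoidD add_closed_submonoid by blast+
    have "\<exists>u. {u..} \<subseteq> U"
      using UV S maximal_proper_submonoid_cofinite by metis
    moreover have "\<exists>v. {v..} \<subseteq> V"
      using UV T maximal_proper_submonoid_cofinite by metis
    ultimately obtain u v where uv: "{u..} \<subseteq> U" "{v..} \<subseteq> V"
      by auto
    \<comment> \<open>One threshold for all four submonoids, so that \<open>Union_bimonoid\<close>
      recovers them and \<open>bimonoid U V\<close> is seen to be proper.\<close>
    define k where "k = Max {c, c', u, v}"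
    have k: "{k..} \<subseteq> U" "{k..} \<subseteq> V" "{k..} \<subseteq> S" "{k..} \<subseteq> T"
      using uv S T by (auto simp: k_def)
    have zero: "0 \<in> U" "0 \<in> V" "0 \<in> S" "0 \<in> T"
      using sub S T by (auto simp: submonoid_nat_add_iff)
    have "\<Union>(bimonoid U V) = U" "\<Union>(rev_set ` bimonoid U V) = V"
      "\<Union>(bimonoid S T) = S" "\<Union>(rev_set ` bimonoid S T) = T"
      unfolding rev_set_image_bimonoid by (rule Union_bimonoid[of _ _ k]; fact k zero)+
    then show ?thesis
      using sub divisor_closed_bimonoid by metis
  qed
  \<comment> \<open>\<open>\<Union>H\<close> and the union of the reversed members determine
    \<open>H\<close>, so one of them is proper; it is enlarged to a maximal submonoid, the other to
    the full one.\<close>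
  have below: "\<exists>U V. ?pair U V \<and> H \<subseteq> bimonoid U V"
    if H: "divisor_closed_submonoid H ?M" "H \<noteq> bimonoid S T" for H
  proof -
    let ?U = "\<Union>H" and ?V = "\<Union>(rev_set ` H)"
    have eq: "H = bimonoid ?U ?V"
      using divisor_closed_eq_bimonoid S T H by blast
    have "H \<subseteq> bimonoid S T"
      using H by (simp add: divisor_closed_sumset_iff)
    then have sub: "?U \<subseteq> S" "?V \<subseteq> T"
      unfolding subset_iff[of H] mem_bimonoid_iff by blast+
    then have subm: "submonoid ?U (nat_add_monoid S)" "submonoid ?V (nat_add_monoid T)"
      using divisor_closed_gen(1,2)[OF H(1)] by (auto simp: submonoid_nat_add_iff)
    have "?U \<noteq> S \<or> ?V \<noteq> T"
      using eq H(2) by metis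
    then show ?thesis
    proof
      assume "?U \<noteq> S"
      then obtain S' where "?U \<subseteq> S'" "maximal_proper_submonoid S' (nat_add_monoid S)"
        using proper_submonoid_subset_maximal[OF S(1) subm(1)] by metis
      then show ?thesis
        using eq sub bimonoid_mono by metis
    next
      assume "?V \<noteq> T"
      then obtain T' where "?V \<subseteq> T'" "maximal_proper_submonoid T' (nat_add_monoid T)"
        using proper_submonoid_subset_maximal[OF T(1) subm(2)] by metis
      then show ?thesis
        using eq sub bimonoid_mono by metis
    qed
  qed
  \<comment> \<open>The inclusion passes to components; mixed pairs would put a full monoid inside a
    maximal proper submonoid.\<close>
  have antichain: "U = U' \<and> V = V'"
    if "?pair U V" "?pair U' V'" "bimonoid U V \<subseteq> bimonoid U' V'" for U V U' V'
  proof -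
    have "U \<subseteq> U'" "V \<subseteq> V'"
      using that pair by (metis Union_mono image_mono)+
    moreover have "T1 = T2" if "maximal_proper_submonoid T1 (nat_add_monoid X)"
      "maximal_proper_submonoid T2 (nat_add_monoid X)" "T1 \<subseteq> T2" for T1 T2 X
      using maximal_proper_submonoidD(4)[OF that(1) _ that(3)] maximal_proper_submonoidD(1,3)[OF that(2)]
      by blast
    moreover have "\<not> X \<subseteq> T1" if "maximal_proper_submonoid T1 (nat_add_monoid X)" for T1 X
      using maximal_proper_submonoidD(2,3)[OF that] by blast
    ultimately show ?thesis
      using that(1,2) by metis
  qed
  show ?thesis
  proof
    assume H: ?maxH
    then obtain U V where "?pair U V" "H \<subseteq> bimonoid U V"
      using below unfolding maximal_divisor_closed_submonoid_def carrier by metis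
    then show "\<exists>U V. H = bimonoid U V \<and> ?pair U V"
      using H pair unfolding maximal_divisor_closed_submonoid_def carrier by (metis psubsetI)
  next
    assume "\<exists>U V. H = bimonoid U V \<and> ?pair U V"
    then obtain U V where UV: "H = bimonoid U V" "?pair U V"
      by blast
    have "H' = H" if H': "divisor_closed_submonoid H' ?M" "H' \<noteq> bimonoid S T" "H \<subseteq> H'" for H'
    proof -
      obtain U' V' where U'V': "?pair U' V'" "H' \<subseteq> bimonoid U' V'"
        using below[OF H'(1,2)] by blast
      have "U = U' \<and> V = V'"
        using antichain[OF UV(2) U'V'(1)] U'V'(2) H'(3) UV(1) by blast
      then show ?thesis
        using U'V'(2) H'(3) UV(1) by blast
    qed
    then show ?maxH
      using pair[OF UV(2)] unfolding maximal_divisor_closed_submonoid_def carrier UV(1) by blast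
  qed
qed

subsection \<open>Sets of natural numbers containing zero\<close>

lemma bimonoid_UNIV:
  "bimonoid S UNIV = Pfin0 S" "bimonoid UNIV T = rev_set ` Pfin0 T"
proof -
  show *: "bimonoid S UNIV = Pfin0 S" for S
    by (auto simp: mem_bimonoid_iff Pfin0_def)
  show "bimonoid UNIV T = rev_set ` Pfin0 T"
    using rev_set_image_bimonoid[of T UNIV] by (simp add: *)
qed

lemma add_closed_UNIV: "add_closed UNIV"
  by (simp add: submonoid_nat_add_iff)

lemma add_closed_one_eq_UNIV: "add_closed S \<Longrightarrow> 1 \<in> S \<Longrightarrow> S = UNIV"
  using add_closed_mult[of S 1] by auto

text \<open>A submonoid containing 1 is everything, so \<open>UNIV - {1}\<close> is the largest
  proper one.\<close>

lemma maximal_proper_submonoid_UNIV_iff: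
  "maximal_proper_submonoid T (nat_add_monoid UNIV) \<longleftrightarrow> T = UNIV - {1}"
proof -
  have one: "add_closed (UNIV - {1})"
    by (auto simp: submonoid_nat_add_iff)
  have "T' \<subseteq> UNIV - {1}" if "add_closed T'" "T' \<noteq> UNIV" for T'
    using that add_closed_one_eq_UNIV by auto
  then show ?thesis
    using one unfolding maximal_proper_submonoid_def nat_add_monoid_def partial_object.simps
    by (smt (verit, best) Diff_iff UNIV_I insertI1 psubsetI psubset_subset_trans psubsetE)
qed

lemma nsum_one_mem: "1 \<in> nsum n A \<Longrightarrow> 0 \<in> A \<Longrightarrow> 1 \<in> A"
proof (induction n)
  case (Suc n)
  then obtain x a where "1 = x + a" "x \<in> nsum n A" "a \<in> A"
    by (auto elim: set_plus_elim)
  moreover from this have "a = 0 \<and> x = 1 \<or> a = 1"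
    by linarith
  ultimately show ?case
    using Suc by auto
qed simp

text \<open>The test set is \<open>{0, 1}\<close>, its own reversal: if it divides
  \<open>nsum n A\<close>, then 1 lies in that sumset and its reversal, hence in \<open>A\<close>
  and \<open>rev_set A\<close>. Conversely, both generated submonoids are \<open>UNIV\<close>, and
  every finite set containing 0 divides some \<open>nsum n A\<close>.\<close>

lemma divisor_hull_eq_UNIV_iff:
  assumes "A \<in> Pfin0 UNIV"
  shows "divisor_hull (sumset_monoid (Pfin0 UNIV)) A = Pfin0 UNIV \<longleftrightarrow> 1 \<in> A \<inter> rev_set A"
proof -
  have A: "finite A" "0 \<in> A"
    using assms by (auto simp: Pfin0_def)
  have hull: "B \<in> divisor_hull (sumset_monoid (Pfin0 UNIV)) A \<longleftrightarrow>
      B \<in> Pfin0 UNIV \<and> (\<exists>n. \<exists>C\<in>Pfin0 UNIV. nsum n A = B + C)" for B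
    unfolding divisor_hull_def pow_sumset_monoid by (auto simp: sumset_monoid_def factor_def)
  show ?thesis
  proof
    assume "divisor_hull (sumset_monoid (Pfin0 UNIV)) A = Pfin0 UNIV"
    moreover have B: "{0, 1} \<in> Pfin0 UNIV"
      by (simp add: Pfin0_def)
    ultimately obtain n C where C: "C \<in> Pfin0 UNIV" "nsum n A = {0, 1} + C"
      using hull by metis
    have rev: "rev_set {0, 1} = {0, 1}"
      by (auto simp: rev_set_def)
    have "{0, 1} \<subseteq> nsum n A" "rev_set {0, 1} \<subseteq> rev_set (nsum n A)"
      using subset_plus_bimonoid[of "{0, 1}" UNIV UNIV C] B C by (simp_all add: bimonoid_UNIV)
    then have "1 \<in> nsum n A" "1 \<in> nsum n (rev_set A)"
      unfolding rev rev_set_nsum[OF A] by auto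
    then show "1 \<in> A \<inter> rev_set A"
      using nsum_one_mem A zero_mem_rev_set[OF A] by blast
  next
    assume "1 \<in> A \<inter> rev_set A"
    then have "gen A = UNIV" "gen (rev_set A) = UNIV"
      using subset_gen[of A] subset_gen[of "rev_set A"] add_closed_one_eq_UNIV[OF add_closed_gen] by auto
    then show "divisor_hull (sumset_monoid (Pfin0 UNIV)) A = Pfin0 UNIV"
      using hull bimonoid_divides_nsum[OF A] by (metis bimonoid_UNIV(1) subsetI subset_antisym)
  qed
qed

section \<open>Chains of divisor-closed submonoids\<close>

lemma infinite_descending_chain:
  defines "H n \<equiv> Pfin0 (insert 0 {n..})"
  shows "divisor_closed_submonoid (H n) (sumset_monoid (Pfin0 UNIV))" "antimono H"
    "\<not> (\<exists>N. \<forall>n\<ge>N. H n = H N)"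
proof -
  have "add_closed (insert 0 {n..})"
    by (auto simp: submonoid_nat_add_iff)
  then show "divisor_closed_submonoid (H n) (sumset_monoid (Pfin0 UNIV))"
    using divisor_closed_bimonoid[of "insert 0 {n..}" UNIV UNIV UNIV] add_closed_UNIV
    by (simp add: H_def bimonoid_UNIV)
  show "antimono H"
    by (auto simp: H_def Pfin0_def antimono_def)
  show "\<not> (\<exists>N. \<forall>n\<ge>N. H n = H N)"
  proof
    assume "\<exists>N. \<forall>n\<ge>N. H n = H N"
    \<comment> \<open>\<open>H 0\<close> and \<open>H 1\<close> coincide, so comparing
      \<open>N\<close> with \<open>Suc N\<close> would give no contradiction for
      \<open>N = 0\<close>.\<close>
    then obtain N where "H (Suc N) = H N" "H (Suc (Suc N)) = H N"
      by (meson le_SucI order_refl)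
    moreover have "{0, Suc N} \<in> H (Suc N)" "{0, Suc N} \<notin> H (Suc (Suc N))"
      by (auto simp: H_def Pfin0_def)
    ultimately show False
      by simp
  qed
qed

text \<open>The union of the chain is again divisor-closed, so a single member \<open>A\<close>
  generates both of its submonoids; any \<open>H N\<close> containing \<open>A\<close> is the whole
  union.\<close>

lemma ascending_chain_stationary:
  fixes H :: "nat \<Rightarrow> nat set set"
  assumes ST: "add_closed S" "add_closed T"
    and H: "\<And>n. divisor_closed_submonoid (H n) (sumset_monoid (bimonoid S T))" and "mono H"
  shows "\<exists>N. \<forall>n\<ge>N. H n = H N"
proof -
  let ?U = "\<Union>(range H)"
  have le: "H i \<subseteq> H j" if "i \<le> j" for i j
    using monoD[OF \<open>mono H\<close> that] .
  note H' = H[unfolded divisor_closed_sumset_iff]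
  have "A + B \<in> ?U" if AB: "A \<in> ?U" "B \<in> ?U" for A B
  proof -
    obtain i j where "A \<in> H i" "B \<in> H j"
      using AB by auto
    then have "A \<in> H (max i j)" "B \<in> H (max i j)"
      using le[of i "max i j"] le[of j "max i j"] by auto
    then show ?thesis
      using H' by blast
  qed
  moreover have "\<forall>B\<in>bimonoid S T. \<forall>C\<in>bimonoid S T. B + C \<in> ?U \<longrightarrow> B \<in> ?U"
    using H' by blast
  moreover have "?U \<subseteq> bimonoid S T" "{0} \<in> ?U"
    using H' by blast+
  ultimately have U: "divisor_closed_submonoid ?U (sumset_monoid (bimonoid S T))"
    unfolding divisor_closed_sumset_iff by blast
  obtain A where A: "A \<in> ?U" "\<Union>?U \<subseteq> gen A" "\<Union>(rev_set ` ?U) \<subseteq> gen (rev_set A)"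
    using divisor_closed_gen(3)[OF U] by auto
  then obtain N where N: "A \<in> H N"
    by auto
  have "?U = bimonoid (\<Union>?U) (\<Union>(rev_set ` ?U))"
    by (rule divisor_closed_eq_bimonoid[OF ST U])
  also have "\<dots> \<subseteq> bimonoid (gen A) (gen (rev_set A))"
    using A by (intro bimonoid_mono)
  also have "\<dots> \<subseteq> H N"
    using mem_divisor_closed_if_mem_bimonoid_gen[OF ST H N] by blast
  finally have "?U \<subseteq> H N" .
  then show ?thesis
    using le by blast
qed

theorem theorem4p5:
  shows
    "(\<forall>A \<in> Pfin0 UNIV.
        divisor_hull (sumset_monoid (Pfin0 UNIV)) A = Pfin0 UNIV \<longleftrightarrow> 1 \<in> A \<inter> rev_set A)
   \<and> ({H. maximal_divisor_closed_submonoid H (sumset_monoid (Pfin0 UNIV))}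
        = {Pfin0 (UNIV - {1}), rev_set ` Pfin0 (UNIV - {1})})
   \<and> (\<forall>S1 S2. numerical_monoid S1 \<longrightarrow> numerical_monoid S2 \<longrightarrow>
        {H. maximal_divisor_closed_submonoid H
              (sumset_monoid (Pfin0 S1 \<inter> rev_set ` Pfin0 S2))}
        = {Pfin0 S1' \<inter> rev_set ` Pfin0 S2 | S1'.
             maximal_proper_submonoid S1' (nat_add_monoid S1)}
        \<union> {Pfin0 S1 \<inter> rev_set ` Pfin0 S2' | S2'.
             maximal_proper_submonoid S2' (nat_add_monoid S2)})
   \<and> (\<exists>H :: nat \<Rightarrow> nat set set.
        (\<forall>n. divisor_closed_submonoid (H n) (sumset_monoid (Pfin0 UNIV)))
        \<and> antimono H \<and> \<not> (\<exists>N. \<forall>n\<ge>N. H n = H N))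
   \<and> (\<forall>H :: nat \<Rightarrow> nat set set.
        (\<forall>n. divisor_closed_submonoid (H n) (sumset_monoid (Pfin0 UNIV)))
        \<and> mono H \<longrightarrow> (\<exists>N. \<forall>n\<ge>N. H n = H N))"
proof (intro conjI allI impI ballI)
  show "divisor_hull (sumset_monoid (Pfin0 UNIV)) A = Pfin0 UNIV \<longleftrightarrow> 1 \<in> A \<inter> rev_set A"
    if "A \<in> Pfin0 UNIV" for A
    using that by (rule divisor_hull_eq_UNIV_iff)
  show "{H. maximal_divisor_closed_submonoid H (sumset_monoid (Pfin0 UNIV))}
        = {Pfin0 (UNIV - {1}), rev_set ` Pfin0 (UNIV - {1})}"
  proof -
    have "maximal_divisor_closed_submonoid H (sumset_monoid (bimonoid UNIV UNIV)) \<longleftrightarrow>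
        H = bimonoid (UNIV - {1}) UNIV \<or> H = bimonoid UNIV (UNIV - {1})" for H
      unfolding maximal_divisor_closed_bimonoid_iff[OF add_closed_UNIV subset_UNIV add_closed_UNIV subset_UNIV]
        maximal_proper_submonoid_UNIV_iff by metis
    then show ?thesis
      unfolding bimonoid_UNIV(1) bimonoid_UNIV(2)[symmetric] by auto
  qed
  show "{H. maximal_divisor_closed_submonoid H
              (sumset_monoid (Pfin0 S1 \<inter> rev_set ` Pfin0 S2))}
        = {Pfin0 S1' \<inter> rev_set ` Pfin0 S2 | S1'.
             maximal_proper_submonoid S1' (nat_add_monoid S1)}
        \<union> {Pfin0 S1 \<inter> rev_set ` Pfin0 S2' | S2'.
             maximal_proper_submonoid S2' (nat_add_monoid S2)}"
    if S: "numerical_monoid S1" "numerical_monoid S2" for S1 S2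
  proof -
    obtain c c' where "{c..} \<subseteq> S1" "{c'..} \<subseteq> S2"
      using S numerical_monoid_cofinite by metis
    moreover have "add_closed S1" "add_closed S2"
      using S by (auto simp: numerical_monoid_def)
    ultimately have "maximal_divisor_closed_submonoid H (sumset_monoid (bimonoid S1 S2)) \<longleftrightarrow>
        (\<exists>U V. H = bimonoid U V \<and>
          (maximal_proper_submonoid U (nat_add_monoid S1) \<and> V = S2 \<or>
           U = S1 \<and> maximal_proper_submonoid V (nat_add_monoid S2)))" for H
      by (intro maximal_divisor_closed_bimonoid_iff)
    then show ?thesis
      unfolding bimonoid_def[symmetric] by auto
  qed
  show "\<exists>H :: nat \<Rightarrow> nat set set.
        (\<forall>n. divisor_closed_submonoid (H n) (sumset_monoid (Pfin0 UNIV)))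
        \<and> antimono H \<and> \<not> (\<exists>N. \<forall>n\<ge>N. H n = H N)"
    by (rule exI[of _ "\<lambda>n. Pfin0 (insert 0 {n..})"]) (intro conjI allI infinite_descending_chain)
  show "\<exists>N. \<forall>n\<ge>N. H n = H N"
    if "(\<forall>n. divisor_closed_submonoid (H n) (sumset_monoid (Pfin0 UNIV))) \<and> mono H"
    for H :: "nat \<Rightarrow> nat set set"
    using that ascending_chain_stationary[OF add_closed_UNIV add_closed_UNIV, of H]
    by (simp add: bimonoid_UNIV)
qed

end
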